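(* Let $X$ be an infinite set and $S \subset \mathrm{Sym}(X)$ a partition-complete set of transpositions. (a) Then $$C_{\mathrm{Sym}(X), S}(q) = \sum_{m=0}^\infty p(m) q^m = \prod_{j=1}^\infty \frac{1}{1-q^j}.$$ In particular the series $C_{\mathrm{Sym}(X), S}(q)$ does not depend on the cardinality of $X$, as long as $X$ is infinite. (b) For every $n \ge 1$, let $S_n \subset \mathrm{Sym}(n)$ be a partition-complete set of transpositions of $\{1,\dots,n\}$. Then $$C_{\mathrm{Sym}(n), S_n}(q) = \sum_{k=0}^{n-1} p_{n-k}(n) q^k \quad (n \ge 1),$$ $$\sum_{n=0}^\infty C_{\mathrm{Sym}(n), S_n}(q)\, t^n = \prod_{j=1}^\infty \frac{1}{1 - q^{j-1} t^j}$$ (where the $n=0$ term is $1$), and when $n \to \infty$ the polynomials $C_{\mathrm{Sym}(n), S_n}(q)$ converge coefficientwise towards the series $C_{\mathrm{Sym}(X), S}(q)$.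
   Context: For a group $G$ generated by a set $S$: the word length $\ell_{G,S}(g)$ is the smallest $n \ge 0$ such that $g = s_1 \cdots s_n$ with $s_i \in S \cup S^{-1}$; the conjugacy length $\kappa_{G,S}(g)$ is the minimum of $\ell_{G,S}(h)$ over all $h$ in the conjugacy class of $g$; $\gamma_{G,S}(n)$ is the number of conjugacy classes of $G$ consisting of elements $g$ with $\kappa_{G,S}(g) = n$. When $\gamma_{G,S}(n)$ is finite for all $n$, the conjugacy growth series is $C_{G,S}(q) = \sum_{n=0}^\infty \gamma_{G,S}(n) q^n$. (Asserting a formula for $C_{G,S}$ includes the assertion that all $\gamma_{G,S}(n)$ are finite.) For a non-empty set $X$, $\mathrm{Sym}(X)$ is the group of permutations of $X$ with finite support; $\mathrm{Sym}(n) = \mathrm{Sym}(\{1,\dots,n\})$. For a set $S$ of transpositions of $X$, the transposition graph $\Gamma(S)$ has vertex set $X$ and an edge $\{x,y\}$ whenever $(x,y) \in S$. The set $S$ is partition-complete if $\Gamma(S)$ is connected (equivalently, $S$ generates $\mathrm{Sym}(X)$) and, for every partition $\lambda = (\lambda_1 \ge \dots \ge \lambda_k \ge 1)$ of an integer $L$ such that $L + k \le |X|$, the graph $\Gamma(S)$ contains (as a subgraph) a forest consisting of $k$ pairwise disjoint trees having respectively $\lambda_1 + 1, \dots, \lambda_k + 1$ vertices. $p(m)$ is the number of partitions of $m$ (with $p(0)=1$), and $p_k(n)$ is the number of partitions of $n$ into exactly $k$ positive parts. *)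

theory Defs
  imports
    "HOL-Analysis.Infinite_Products"
    "HOL-Library.Disjoint_Sets"
    "HOL-Computational_Algebra.Formal_Power_Series"
    "HOL-Combinatorics.Transposition"
    "HOL-Combinatorics.Permutations"
    "HOL-Algebra.Sym_Groups"
begin

section \<open>Conjugacy growth\<close>

text \<open>The set \<open>S\<close> is meant to generate \<open>G\<close>; otherwise \<open>LEAST\<close> is taken over an empty set for
  elements outside the generated subgroup.\<close>

definition word_length :: "('g, 'b) monoid_scheme \<Rightarrow> 'g set \<Rightarrow> 'g \<Rightarrow> nat" where
  "word_length G S g =
     (LEAST n. \<exists>ws. length ws = n \<and> set ws \<subseteq> S \<union> m_inv G ` S \<and>
                    g = foldr (\<otimes>\<^bsub>G\<^esub>) ws \<one>\<^bsub>G\<^esub>)"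

definition conj_class :: "('g, 'b) monoid_scheme \<Rightarrow> 'g \<Rightarrow> 'g set" where
  "conj_class G g = {h \<otimes>\<^bsub>G\<^esub> g \<otimes>\<^bsub>G\<^esub> inv\<^bsub>G\<^esub> h | h. h \<in> carrier G}"

definition conj_length :: "('g, 'b) monoid_scheme \<Rightarrow> 'g set \<Rightarrow> 'g \<Rightarrow> nat" where
  "conj_length G S g = (LEAST n. \<exists>h\<in>conj_class G g. word_length G S h = n)"

definition conj_classes_of_length :: "('g, 'b) monoid_scheme \<Rightarrow> 'g set \<Rightarrow> nat \<Rightarrow> 'g set set" where
  "conj_classes_of_length G S n =
     {K \<in> conj_class G ` carrier G. \<forall>g\<in>K. conj_length G S g = n}"

definition conj_growth :: "('g, 'b) monoid_scheme \<Rightarrow> 'g set \<Rightarrow> nat \<Rightarrow> nat" where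
  "conj_growth G S n = card (conj_classes_of_length G S n)"

text \<open>Since \<open>card\<close> of an infinite set is \<open>0\<close>, the series below is only meaningful together with the
  following finiteness condition.\<close>

definition finite_conj_growth :: "('g, 'b) monoid_scheme \<Rightarrow> 'g set \<Rightarrow> bool" where
  "finite_conj_growth G S \<longleftrightarrow> (\<forall>n. finite (conj_classes_of_length G S n))"

definition conj_growth_series :: "('g, 'b) monoid_scheme \<Rightarrow> 'g set \<Rightarrow> real fps" where
  "conj_growth_series G S = Abs_fps (\<lambda>n. real (conj_growth G S n))"


section \<open>Finitary symmetric groups\<close>

text \<open>Permutations of \<open>X\<close> are functions on the ambient type that fix every point outside \<open>X\<close>.\<close>

definition fsym_group :: "'a set \<Rightarrow> ('a \<Rightarrow> 'a) monoid" where
  "fsym_group X =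
     \<lparr>carrier = {p. p permutes X \<and> finite {x. p x \<noteq> x}}, mult = (\<circ>), one = id\<rparr>"

lemma group_fsym_group: "group (fsym_group X)"
proof (rule groupI)
  fix p q assume "p \<in> carrier (fsym_group X)" "q \<in> carrier (fsym_group X)"
  moreover have "{x. (p \<circ> q) x \<noteq> x} \<subseteq> {x. p x \<noteq> x} \<union> {x. q x \<noteq> x}"
    by auto
  ultimately show "p \<otimes>\<^bsub>fsym_group X\<^esub> q \<in> carrier (fsym_group X)"
    unfolding fsym_group_def by (auto intro: permutes_compose finite_subset)
next
  fix p assume "p \<in> carrier (fsym_group X)"
  then have p: "p permutes X" "finite {x. p x \<noteq> x}"
    by (auto simp: fsym_group_def)
  have "{x. inv' p x \<noteq> x} = {x. p x \<noteq> x}"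
    using permutes_inv_eq[OF p(1)] by metis
  then show "\<exists>q\<in>carrier (fsym_group X). q \<otimes>\<^bsub>fsym_group X\<^esub> p = \<one>\<^bsub>fsym_group X\<^esub>"
    using p by (intro bexI[of _ "inv' p"])
      (auto simp: fsym_group_def permutes_inv permutes_inv_o)
qed (auto simp: fsym_group_def permutes_id comp_assoc)

lemma fsym_group_eq_sym_group: "fsym_group {1..n} = sym_group n"
proof -
  have "finite {x. p x \<noteq> x}" if "p permutes {1..n}" for p
    by (rule finite_subset[of _ "{1..n}"]) (use that in \<open>auto simp: permutes_def\<close>)
  then show ?thesis
    unfolding fsym_group_def sym_group_def by auto
qed


section \<open>Integer partitions\<close>

definition int_partition :: "nat list \<Rightarrow> nat \<Rightarrow> bool" where
  "int_partition l n \<longleftrightarrow> sorted_wrt (\<ge>) l \<and> (\<forall>i\<in>set l. 1 \<le> i) \<and> sum_list l = n"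

definition num_partitions :: "nat \<Rightarrow> nat" where
  "num_partitions n = card {l. int_partition l n}"

definition num_partitions_into :: "nat \<Rightarrow> nat \<Rightarrow> nat" where
  "num_partitions_into k n = card {l. int_partition l n \<and> length l = k}"


section \<open>Partition-complete sets of transpositions\<close>

text \<open>A simple graph is given by its vertex set and its set of two-element edges.\<close>

definition simple_graph :: "'a set \<Rightarrow> 'a set set \<Rightarrow> bool" where
  "simple_graph V E \<longleftrightarrow> E \<subseteq> {{x, y} | x y. x \<in> V \<and> y \<in> V \<and> x \<noteq> y}"

definition connected_graph :: "'a set \<Rightarrow> 'a set set \<Rightarrow> bool" where
  "connected_graph V E \<longleftrightarrow> (\<forall>x\<in>V. \<forall>y\<in>V. (x, y) \<in> {(u, v). {u, v} \<in> E}\<^sup>*)"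

definition has_cycle :: "'a set set \<Rightarrow> bool" where
  "has_cycle E \<longleftrightarrow>
     (\<exists>c. 3 \<le> length c \<and> distinct c \<and>
          (\<forall>i<length c. {c ! i, c ! (Suc i mod length c)} \<in> E))"

definition tree :: "'a set \<Rightarrow> 'a set set \<Rightarrow> bool" where
  "tree V E \<longleftrightarrow> simple_graph V E \<and> V \<noteq> {} \<and> connected_graph V E \<and> \<not> has_cycle E"

definition contains_forest :: "'a set \<Rightarrow> 'a set set \<Rightarrow> nat list \<Rightarrow> bool" where
  "contains_forest X E l \<longleftrightarrow>
     (\<exists>V F. (\<forall>i<length l. V i \<subseteq> X \<and> F i \<subseteq> E \<and> tree (V i) (F i) \<and> card (V i) = l ! i) \<and>
            disjoint_family_on V {..<length l})"

definition transposition_set :: "'a set \<Rightarrow> ('a \<Rightarrow> 'a) set \<Rightarrow> bool" where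
  "transposition_set X S \<longleftrightarrow>
     S \<subseteq> {Transposition.transpose x y | x y. x \<in> X \<and> y \<in> X \<and> x \<noteq> y}"

definition transposition_edges :: "('a \<Rightarrow> 'a) set \<Rightarrow> 'a set set" where
  "transposition_edges S = {{x, y} | x y. x \<noteq> y \<and> Transposition.transpose x y \<in> S}"

text \<open>For infinite \<open>X\<close> the size restriction \<open>L + k \<le> |X|\<close> is void.\<close>

definition partition_complete :: "'a set \<Rightarrow> ('a \<Rightarrow> 'a) set \<Rightarrow> bool" where
  "partition_complete X S \<longleftrightarrow>
     connected_graph X (transposition_edges S) \<and>
     (\<forall>l L. int_partition l L \<and> (finite X \<longrightarrow> L + length l \<le> card X) \<longrightarrow>
            contains_forest X (transposition_edges S) (map Suc l))"

end

(* A conjugacy class of finitary permutations is a cycle type, i.e. a partition l of some n, the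
   nontrivial cycles having lengths l_i + 1; the sum of l + length l moved points must fit into X.
   If a product of m transpositions has this type, then some labelling of the moved points is
   constant on its cycles and takes at least n + length l - m values (each transposition merges at
   most two labels), so m >= n.  Conversely, the edges of a tree with l_i + 1 vertices, taken in an
   order in which the tree grows by one vertex at a time, multiply to a cycle through all its
   vertices, so a forest as in partition-completeness yields an element of the class of word
   length n.  Hence the classes of length n correspond to the partitions l of n with
   n + length l <= |X|; the generating functions are obtained by removing a largest part. *)

theory Submission
  imports Defs
begin

section \<open>Generating functions of partitions\<close>

lemma int_partition_le:
  assumes "int_partition l n" "i \<in> set l"
  shows "i \<le> n"
  using assms member_le_sum_list[of i l] by (auto simp: int_partition_def)

lemma length_le_sum_list:
  fixes l :: "nat list"
  assumes "\<forall>i\<in>set l. 1 \<le> i"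
  shows "length l \<le> sum_list l"
  using assms by (induction l) (auto simp: Suc_le_eq)

lemma finite_int_partition: "finite {l. int_partition l n}"
proof (rule finite_subset)
  show "{l. int_partition l n} \<subseteq> {l. set l \<subseteq> {..n} \<and> length l \<le> n}"
    using int_partition_le length_le_sum_list by (force simp: int_partition_def)
qed (simp add: finite_lists_length_le)

lemma int_partition_0: "int_partition l 0 \<longleftrightarrow> l = []"
  by (cases l) (auto simp: int_partition_def)

text \<open>The first \<open>J\<close> factors of the infinite product involve only parts up to
  \<open>J\<close>, hence the truncation by the largest part.\<close>

definition bounded_partitions :: "nat \<Rightarrow> nat \<Rightarrow> nat list set" where
  "bounded_partitions J n = {l. int_partition l n \<and> (\<forall>i\<in>set l. i \<le> J)}"

lemma finite_bounded_partitions [simp]: "finite (bounded_partitions J n)"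
  unfolding bounded_partitions_def by (rule finite_subset[OF _ finite_int_partition]) auto

lemma bounded_partitions_0: "bounded_partitions 0 n = (if n = 0 then {[]} else {})"
proof -
  have "l = [] \<and> n = 0" if "l \<in> bounded_partitions 0 n" for l
    using that by (cases l) (auto simp: bounded_partitions_def int_partition_def)
  moreover have "[] \<in> bounded_partitions 0 0"
    by (simp add: bounded_partitions_def int_partition_def)
  ultimately show ?thesis
    by auto
qed

text \<open>In a weakly decreasing list with entries up to \<open>Suc J\<close>, the value
  \<open>Suc J\<close> occurs only if it is the head. Deleting it leaves a list in which it may
  occur again.\<close>

lemma bounded_partitions_Suc:
  "bounded_partitions (Suc J) n = bounded_partitions J n \<union>
     (if Suc J \<le> n then Cons (Suc J) ` bounded_partitions (Suc J) (n - Suc J) else {})"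
    (is "?L = _ \<union> ?R")
proof (intro equalityI subsetI)
  fix l assume l: "l \<in> ?L"
  show "l \<in> bounded_partitions J n \<union> ?R"
  proof (cases l)
    case Nil
    then show ?thesis using l by (auto simp: bounded_partitions_def)
  next
    case (Cons a l')
    show ?thesis
    proof (cases "a = Suc J")
      case True
      then show ?thesis using l Cons
        by (auto simp: bounded_partitions_def int_partition_def)
    next
      case False
      then have "\<forall>i\<in>set l. i \<le> J"
        using l Cons by (force simp: bounded_partitions_def int_partition_def)
      then show ?thesis using l by (auto simp: bounded_partitions_def)
    qed
  qed
next
  fix l assume "l \<in> bounded_partitions J n \<union> ?R"
  then show "l \<in> ?L"
    by (auto simp: bounded_partitions_def int_partition_def split: if_splits)
qed

text \<open>A weight \<open>z i\<close> for every part \<open>i\<close> lets one product formula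
  serve both series of the theorem: \<open>z i = 1\<close> counts all partitions, and
  \<open>z i = fps_X ^ (i - 1)\<close> brings in a second variable.\<close>

definition bounded_partition_series :: "(nat \<Rightarrow> 'a::comm_ring_1) \<Rightarrow> nat \<Rightarrow> 'a fps" where
  "bounded_partition_series z J =
     Abs_fps (\<lambda>n. \<Sum>l\<in>bounded_partitions J n. prod_list (map z l))"

lemma bounded_partition_series_0: "bounded_partition_series z 0 = 1"
  by (rule fps_ext) (simp add: bounded_partition_series_def bounded_partitions_0)

text \<open>Splitting off a head \<open>Suc J\<close> gives
  \<open>B = A + z (Suc J) * t ^ Suc J * B\<close>, where \<open>A\<close> and \<open>B\<close> are
  the series for \<open>J\<close> and \<open>Suc J\<close> in the variable \<open>t\<close>.\<close>

lemma bounded_partition_series_Suc: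
  "bounded_partition_series z (Suc J) * (1 - fps_const (z (Suc J)) * fps_X ^ Suc J) =
     bounded_partition_series z J"
proof -
  have "bounded_partition_series z (Suc J) = bounded_partition_series z J +
          fps_const (z (Suc J)) * (fps_X ^ Suc J * bounded_partition_series z (Suc J))"
  proof (rule fps_ext)
    fix n
    show "fps_nth (bounded_partition_series z (Suc J)) n = fps_nth (bounded_partition_series z J +
            fps_const (z (Suc J)) * (fps_X ^ Suc J * bounded_partition_series z (Suc J))) n"
    proof (cases "Suc J \<le> n")
      case True
      have "bounded_partitions J n \<inter> Cons (Suc J) ` bounded_partitions (Suc J) (n - Suc J) = {}"
        by (auto simp: bounded_partitions_def)
      then have "(\<Sum>l\<in>bounded_partitions (Suc J) n. prod_list (map z l)) =
            (\<Sum>l\<in>bounded_partitions J n. prod_list (map z l)) +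
            (\<Sum>l\<in>Cons (Suc J) ` bounded_partitions (Suc J) (n - Suc J). prod_list (map z l))"
        using True by (subst bounded_partitions_Suc) (simp add: sum.union_disjoint)
      also have "(\<Sum>l\<in>Cons (Suc J) ` bounded_partitions (Suc J) (n - Suc J). prod_list (map z l)) =
            z (Suc J) * (\<Sum>l\<in>bounded_partitions (Suc J) (n - Suc J). prod_list (map z l))"
        by (subst sum.reindex) (auto simp: sum_distrib_left)
      finally show ?thesis
        using True
        by (simp add: bounded_partition_series_def fps_X_power_mult_nth del: power_Suc)
    next
      case False
      then show ?thesis
        using bounded_partitions_Suc[of J n]
        by (simp add: bounded_partition_series_def fps_X_power_mult_nth del: power_Suc)
    qed
  qed
  then show ?thesis
    by (simp add: algebra_simps)
qed

text \<open>Only \<open>g j = inverse (1 - \<dots>)\<close> is of interest, but \<open>real fps\<close> is not a division ring, so the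
  library has no rewrite rules for \<open>inverse\<close> on \<open>real fps fps\<close>.\<close>

lemma partition_product:
  fixes z :: "nat \<Rightarrow> 'a::comm_ring_1"
  assumes g: "\<And>j. (1 - fps_const (z (Suc j)) * fps_X ^ Suc j) * g j = 1"
  shows "g has_prod Abs_fps (\<lambda>n. \<Sum>l\<in>{l. int_partition l n}. prod_list (map z l))"
    (is "g has_prod ?A")
proof -
  have partial: "(\<Prod>j<J. g j) = bounded_partition_series z J" for J
  proof (induction J)
    case (Suc J)
    have "(\<Prod>j<Suc J. g j) = bounded_partition_series z J * g J"
      using Suc by simp
    also have "\<dots> = bounded_partition_series z (Suc J) *
            ((1 - fps_const (z (Suc J)) * fps_X ^ Suc J) * g J)"
      by (subst bounded_partition_series_Suc[symmetric]) (simp only: mult.assoc)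
    finally show ?case
      by (simp only: g mult_1_right)
  qed (simp add: bounded_partition_series_0)
  have "bounded_partitions J n = {l. int_partition l n}" if "n \<le> J" for J n
    using that int_partition_le order_trans by (fastforce simp: bounded_partitions_def)
  \<comment> \<open>Coefficient \<open>n\<close> no longer changes once \<open>n \<le> J\<close>.
    The index \<open>Suc J\<close> is the number of factors in a partial product over
    \<open>{..J}\<close>.\<close>
  then have "\<forall>\<^sub>F J in sequentially. fps_nth (bounded_partition_series z (Suc J)) n = fps_nth ?A n" for n
    by (intro eventually_sequentiallyI[of n]) (simp add: bounded_partition_series_def)
  then have "(\<lambda>J. bounded_partition_series z (Suc J)) \<longlonglongrightarrow> ?A"
    by (rule tendsto_fpsI)
  \<comment> \<open>\<open>raw_has_prod\<close> demands a nonzero limit; the empty partition makes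
    the constant coefficient 1.\<close>
  moreover have "fps_nth ?A 0 = 1"
    by (simp add: int_partition_0)
  then have "?A \<noteq> 0"
    by (metis fps_zero_nth zero_neq_one)
  ultimately show ?thesis
    by (simp add: has_prod_def raw_has_prod_def partial del: prod.lessThan_Suc flip: lessThan_Suc_atMost)
qed

text \<open>The coefficients need not form a field: it is enough that \<open>inverse\<close> really
  inverts the constant coefficient. This covers series over \<open>real fps\<close>.\<close>

lemma fps_mult_inverse_comm:
  fixes f :: "'a::{comm_ring_1,inverse} fps"
  assumes "fps_nth f 0 * inverse (fps_nth f 0) = 1"
  shows "f * inverse f = 1"
  using fps_right_inverse[OF assms] by (simp add: fps_inverse_def)

section \<open>Product formulas in one and in two variables\<close>

lemma partition_product_num_partitions:
  "(\<lambda>j. inverse (1 - fps_X ^ Suc j)) has_prod Abs_fps (\<lambda>m. real (num_partitions m))"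
  using partition_product[of "\<lambda>_. 1::real" "\<lambda>j. inverse (1 - fps_X ^ Suc j)"]
  by (simp add: inverse_mult_eq_1' num_partitions_def map_replicate_const del: power_Suc)

lemma prod_list_power:
  fixes q :: "'a::comm_monoid_mult"
  shows "prod_list (map (\<lambda>i. q ^ f i) l) = q ^ sum_list (map f l)"
  by (induction l) (auto simp: power_add)

text \<open>The weights of the parts of \<open>l\<close> multiply to
  \<open>fps_X ^ (n - length l)\<close>, so collecting the partitions of \<open>n\<close> by
  \<open>k = n - length l\<close> produces the polynomial that counts partitions into
  \<open>n - k\<close> parts.\<close>

lemma partition_product_num_partitions_into:
  "(\<lambda>j. inverse (1 - fps_const (fps_X ^ j) * fps_X ^ Suc j)) has_prod
     Abs_fps (\<lambda>n. if n = 0 then 1 else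
       \<Sum>k=0..n-1. fps_const (real (num_partitions_into (n - k) n)) * fps_X ^ k)"
proof -
  \<comment> \<open>A part \<open>i\<close> stands for a cycle of length \<open>i\<close>, which
    costs \<open>i - 1\<close> transpositions. At \<open>i = Suc j\<close> this is the weight
    \<open>fps_X ^ j\<close> in the product.\<close>
  let ?z = "\<lambda>i. fps_X ^ (i - 1) :: real fps"
  have "(\<lambda>j. inverse (1 - fps_const (fps_X ^ j) * fps_X ^ Suc j) :: real fps fps) has_prod
          Abs_fps (\<lambda>n. \<Sum>l\<in>{l. int_partition l n}. prod_list (map ?z l))"
    by (rule partition_product, subst diff_Suc_1, rule fps_mult_inverse_comm)
      (simp del: power_Suc add: fps_inverse_one')
  moreover have "(\<Sum>l\<in>{l. int_partition l n}. prod_list (map ?z l)) =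
      (if n = 0 then 1 else
        \<Sum>k=0..n-1. fps_const (real (num_partitions_into (n - k) n)) * fps_X ^ k)" for n
  proof (cases "n = 0")
    case False
    have z: "prod_list (map ?z l) = fps_X ^ (n - length l)"
      and len: "length l \<in> {1..n}" if "int_partition l n" for l
    proof -
      have "sum_list l = sum_list (map (\<lambda>i. i - 1) l) + length l" if "\<forall>i\<in>set l. 1 \<le> i" for l :: "nat list"
        using that by (induction l) auto
      then show "prod_list (map ?z l) = fps_X ^ (n - length l)"
        using that unfolding prod_list_power int_partition_def by (metis add_diff_cancel_right')
      show "length l \<in> {1..n}"
        using that False length_le_sum_list[of l] by (cases l) (auto simp: int_partition_def)
    qed
    have "(\<Sum>l\<in>{l. int_partition l n}. prod_list (map ?z l)) =
          (\<Sum>l\<in>{l. int_partition l n}. fps_X ^ (n - length l))"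
      using z by simp
    \<comment> \<open>For \<open>n \<noteq> 0\<close> a partition of \<open>n\<close> has between 1
      and \<open>n\<close> parts, so the exponents lie in \<open>{0..n-1}\<close> and no subtraction
      is truncated.\<close>
    also have "\<dots> = (\<Sum>k\<in>{0..n-1}. \<Sum>l\<in>{l \<in> {l. int_partition l n}. n - length l = k}. fps_X ^ (n - length l))"
      using len by (intro sum.group[symmetric] finite_int_partition) fastforce+
    also have "\<dots> = (\<Sum>k=0..n-1. fps_const (real (num_partitions_into (n - k) n)) * fps_X ^ k)"
    proof (rule sum.cong[OF refl])
      fix k assume k: "k \<in> {0..n-1}"
      have "{l \<in> {l. int_partition l n}. n - length l = k} = {l. int_partition l n \<and> length l = n - k}"
        using k False len by fastforce
      then show "(\<Sum>l\<in>{l \<in> {l. int_partition l n}. n - length l = k}. fps_X ^ (n - length l)) =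
            fps_const (real (num_partitions_into (n - k) n)) * fps_X ^ k"
        using k False by (auto simp: num_partitions_into_def simp flip: fps_of_nat)
    qed
    finally show ?thesis using False by simp
  qed (simp add: int_partition_0)
  ultimately show ?thesis by simp
qed

text \<open>The ones of a weakly decreasing list form a final segment. Lowering all parts by 1 and
  deleting the zeros therefore loses only the number of ones, which the length recovers.\<close>

lemma map_pred_filter:
  fixes l :: "nat list"
  assumes "sorted_wrt (\<ge>) l" "\<forall>i\<in>set l. 1 \<le> i"
  defines "l' \<equiv> filter (\<lambda>i. 0 < i) (map (\<lambda>i. i - 1) l)"
  shows "map Suc l' @ replicate (length l - length l') 1 = l"
  using assms(1,2) unfolding l'_def
proof (induction l)
  case (Cons a l)
  show ?case
  proof (cases "a = 1")
    case True
    then have "\<forall>i\<in>set (a # l). i = 1"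
      using Cons.prems by (auto intro: antisym)
    then have "a # l = replicate (length (a # l)) 1"
      by (metis replicate_length_same)
    then show ?thesis
      by (metis (no_types, lifting) True append_Nil diff_zero filter_False filter_replicate
          list.map(1) list.size(3) map_replicate diff_self_eq_0 less_irrefl)
  next
    case False
    then show ?thesis
      using Cons by auto
  qed
qed simp

text \<open>Subtract 1 from each of the \<open>n - k\<close> parts and delete the zeros.\<close>

lemma card_partitions_fitting:
  assumes "k < n"
  shows "card {l. int_partition l k \<and> k + length l \<le> n} = num_partitions_into (n - k) n"
  unfolding num_partitions_into_def
proof (rule bij_betw_same_card, rule bij_betw_byWitness)
  \<comment> \<open>In terms of permutations of \<open>n\<close> points, \<open>map Suc l\<close>
    lists the nontrivial cycle lengths and the padding ones are the fixed points; filling up to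
    \<open>n - k\<close> parts makes the sum \<open>n\<close>.\<close>
  let ?f = "\<lambda>l. map Suc l @ replicate (n - k - length l) 1"
  let ?g = "\<lambda>l. filter (\<lambda>i. 0 < i) (map (\<lambda>i. i - 1) l)"
  have sum_Suc: "sum_list (map Suc l) = sum_list l + length l" for l
    by (induction l) auto
  have sorted_replicate: "sorted_wrt (\<ge>) (replicate m (Suc 0))" for m
    by (induction m) auto
  have sum_pred: "sum_list l = sum_list (?g l) + length l" if "\<forall>i\<in>set l. 1 \<le> i" for l
    using that by (induction l) auto
  show "?f ` {l. int_partition l k \<and> k + length l \<le> n} \<subseteq> {l. int_partition l n \<and> length l = n - k}"
    by (auto simp: int_partition_def sum_Suc sum_list_replicate sorted_wrt_append sorted_wrt_map
        sorted_replicate)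
  show "?g ` {l. int_partition l n \<and> length l = n - k} \<subseteq> {l. int_partition l k \<and> k + length l \<le> n}"
  proof (rule image_subsetI)
    fix l assume "l \<in> {l. int_partition l n \<and> length l = n - k}"
    then have l: "int_partition l n" "length l = n - k" by auto
    then have "sum_list (?g l) = k"
      using sum_pred[of l] assms by (auto simp: int_partition_def)
    moreover have "sorted_wrt (\<ge>) (?g l)"
      using l by (intro sorted_wrt_filter) (auto simp: int_partition_def sorted_wrt_map
          intro: sorted_wrt_mono_rel[rotated])
    moreover have "length (?g l) \<le> n - k"
      using l(2) by (metis length_filter_le length_map)
    ultimately show "?g l \<in> {l. int_partition l k \<and> k + length l \<le> n}"
      using assms by (auto simp: int_partition_def)
  qed
  show "\<forall>l\<in>{l. int_partition l k \<and> k + length l \<le> n}. ?g (?f l) = l"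
    by (auto simp: int_partition_def filter_id_conv comp_def Suc_le_eq)
  show "\<forall>l\<in>{l. int_partition l n \<and> length l = n - k}. ?f (?g l) = l"
  proof (rule ballI)
    fix l assume "l \<in> {l. int_partition l n \<and> length l = n - k}"
    then show "?f (?g l) = l"
      using map_pred_filter[of l] by (simp add: int_partition_def)
  qed
qed


section \<open>Products of disjoint cycles and cycle types\<close>

text \<open>Disjointness is imposed separately as \<open>distinct (concat css)\<close>, which says
  at once that no cycle repeats a point and that no two cycles meet.\<close>

definition cycle_product :: "'a list list \<Rightarrow> 'a \<Rightarrow> 'a" where
  "cycle_product css = foldr (\<lambda>cs p. cycle_of_list cs \<circ> p) css id"

lemma cycle_product_simps [simp]:
  "cycle_product [] = id"
  "cycle_product (cs # css) = cycle_of_list cs \<circ> cycle_product css"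
  by (simp_all add: cycle_product_def)

lemma cycle_of_list_in_set_iff [simp]: "cycle_of_list cs x \<in> set cs \<longleftrightarrow> x \<in> set cs"
  by (rule permutes_in_image[OF cycle_permutes])

lemma cycle_product_outside:
  assumes "x \<notin> set (concat css)"
  shows "cycle_product css x = x"
  using assms by (induction css) (auto simp: id_outside_supp)

lemma cycle_product_inside:
  assumes "distinct (concat css)" "cs \<in> set css" "x \<in> set cs"
  shows "cycle_product css x = cycle_of_list cs x"
  using assms
proof (induction css)
  case (Cons ds css)
  show ?case
  proof (cases "cs \<in> set css")
    case True
    have "cycle_of_list cs x \<in> set cs"
      using Cons.prems by simp
    moreover have "set ds \<inter> set cs = {}"
      using Cons.prems True by auto
    ultimately have "cycle_of_list cs x \<notin> set ds"
      by blast
    then show ?thesis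
      using Cons True by (auto simp: id_outside_supp)
  next
    case False
    then have "cs = ds" "x \<notin> set (concat css)"
      using Cons.prems by auto
    then show ?thesis
      by (simp add: cycle_product_outside del: set_concat)
  qed
qed simp

lemma cycle_product_permutes: "cycle_product css permutes set (concat css)"
proof (induction css)
  case (Cons cs css)
  have "cycle_product css permutes set (concat (cs # css))"
    by (rule permutes_subset[OF Cons]) simp
  moreover have "cycle_of_list cs permutes set (concat (cs # css))"
    by (rule permutes_subset[OF cycle_permutes]) simp
  ultimately show ?case
    unfolding cycle_product_simps by (rule permutes_compose)
qed (simp only: cycle_product_simps permutes_id)

text \<open>Disjoint cycles commute: the value at a point depends only on the cycle that contains
  it.\<close>

lemma cycle_product_perm:
  assumes "distinct (concat css)" "mset css' = mset css"
  shows "cycle_product css' = cycle_product css"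
proof
  fix x
  have "mset (concat css') = mset (concat css)"
    using assms(2) by (metis mset_concat mset_map sum_mset_sum_list)
  then have d: "distinct (concat css')"
    using assms(1) mset_eq_imp_distinct_iff by blast
  have s: "set css' = set css"
    using assms(2) by (rule mset_eq_setD)
  show "cycle_product css' x = cycle_product css x"
  proof (cases "x \<in> set (concat css)")
    case True
    then show ?thesis using d s assms(1) by (auto simp: cycle_product_inside)
  next
    case False
    then show ?thesis using s by (simp add: cycle_product_outside)
  qed
qed

lemma conjugate_cycle_product:
  assumes "distinct (concat css)" "bij h"
  shows "h \<circ> cycle_product css \<circ> inv' h = cycle_product (map (map h) css)"
  using assms
proof (induction css)
  case Nil
  then show ?case using surj_iff[of h] by (simp add: bij_is_surj)
next
  case (Cons cs css)
  have "h \<circ> cycle_product (cs # css) \<circ> inv' h =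
      (h \<circ> cycle_of_list cs \<circ> inv' h) \<circ> (h \<circ> cycle_product css \<circ> inv' h)"
    using \<open>bij h\<close> by (auto simp: fun_eq_iff bij_is_inj)
  also have "h \<circ> cycle_of_list cs \<circ> inv' h = cycle_of_list (map h cs)"
    using Cons.prems by (intro conjugation_of_cycle) auto
  also have "h \<circ> cycle_product css \<circ> inv' h = cycle_product (map (map h) css)"
    using Cons.prems by (intro Cons.IH) auto
  also have "cycle_of_list (map h cs) \<circ> \<dots> = cycle_product (map (map h) (cs # css))"
    by simp
  finally show ?case .
qed

text \<open>The cycle sends each entry to the next one, so the label of \<open>cs ! 0\<close>
  propagates along the list.\<close>

lemma invariant_cycle_of_list:
  assumes "distinct cs" "\<And>y. c (cycle_of_list cs y) = c y" "x \<in> set cs" "y \<in> set cs"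
  shows "c x = c y"
proof -
  have "c (cs ! i) = c (cs ! 0)" if "i < length cs" for i
    using that
  proof (induction i)
    case (Suc i)
    have "map (cycle_of_list cs) cs ! i = rotate1 cs ! i"
      using cyclic_rotation[OF assms(1), of 1] by simp
    then have "cycle_of_list cs (cs ! i) = cs ! Suc i"
      using Suc.prems by (simp add: nth_rotate1)
    then show ?case
      using Suc assms(2)[of "cs ! i"] by simp
  qed simp
  then show ?thesis
    using assms(3,4) by (metis in_set_conv_nth)
qed

lemma invariant_cycle_product:
  assumes "distinct (concat css)" "\<And>y. c (cycle_product css y) = c y"
    and "cs \<in> set css" "x \<in> set cs" "y \<in> set cs"
  shows "c x = c y"
proof (rule invariant_cycle_of_list[of cs c])
  show "distinct cs"
    using assms(1,3) by (auto simp: distinct_concat_iff)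
  show "c (cycle_of_list cs z) = c z" for z
    using assms(2)[of z] cycle_product_inside[OF assms(1,3), of z] id_outside_supp[of z cs]
    by (cases "z \<in> set cs") auto
qed (use assms in auto)

text \<open>The support of a cycle consists of the points that no invariant set separates from one of
  its elements; hence the product determines the supports.\<close>

lemma cycle_support_eq:
  assumes "distinct (concat css)" "cs \<in> set css" "x \<in> set cs"
  shows "set cs = {y. \<forall>A. (\<forall>z. cycle_product css z \<in> A \<longleftrightarrow> z \<in> A) \<longrightarrow> (x \<in> A \<longleftrightarrow> y \<in> A)}"
proof (intro equalityI subsetI)
  fix y assume y: "y \<in> set cs"
  show "y \<in> {y. \<forall>A. (\<forall>z. cycle_product css z \<in> A \<longleftrightarrow> z \<in> A) \<longrightarrow> (x \<in> A \<longleftrightarrow> y \<in> A)}"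
  proof clarify
    fix A assume "\<forall>z. cycle_product css z \<in> A \<longleftrightarrow> z \<in> A"
    then show "x \<in> A \<longleftrightarrow> y \<in> A"
      using invariant_cycle_product[OF assms(1) _ assms(2,3) y, of "\<lambda>z. z \<in> A"] by blast
  qed
next
  fix y assume y: "y \<in> {y. \<forall>A. (\<forall>z. cycle_product css z \<in> A \<longleftrightarrow> z \<in> A) \<longrightarrow> (x \<in> A \<longleftrightarrow> y \<in> A)}"
  \<comment> \<open>The support itself is an invariant set, so taking \<open>A = set cs\<close>
    confines \<open>y\<close> to it.\<close>
  have "cycle_product css z \<in> set cs \<longleftrightarrow> z \<in> set cs" for z
  proof (cases "z \<in> set (concat css)")
    case True
    then obtain ds where ds: "ds \<in> set css" "z \<in> set ds" by auto
    then have "cycle_product css z \<in> set ds"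
      using assms(1) by (simp add: cycle_product_inside)
    moreover have "ds = cs \<or> set ds \<inter> set cs = {}"
      using assms(1,2) ds by (auto simp: distinct_concat_iff)
    ultimately show ?thesis using ds by auto
  qed (simp add: cycle_product_outside)
  then show "y \<in> set cs" using y assms(3) by auto
qed

text \<open>A part \<open>i\<close> encodes a cycle of length \<open>Suc i\<close>, so that fixed
  points leave no trace and \<open>sum_list l\<close> becomes the conjugacy length.\<close>

definition cycle_type_lists :: "'a set \<Rightarrow> nat list \<Rightarrow> 'a list list set" where
  "cycle_type_lists X l =
     {css. distinct (concat css) \<and> set (concat css) \<subseteq> X \<and> map length css = map Suc l}"

definition cycle_type_class :: "'a set \<Rightarrow> nat list \<Rightarrow> ('a \<Rightarrow> 'a) set" where
  "cycle_type_class X l = cycle_product ` cycle_type_lists X l"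

text \<open>If \<open>x\<close> were fixed, injectivity would make the predicate
  \<open>y = x\<close> invariant, hence constant on the cycle, which would then consist of
  \<open>x\<close> alone.\<close>

lemma cycle_product_moves:
  assumes "distinct (concat css)" "cs \<in> set css" "x \<in> set cs" "2 \<le> length cs"
  shows "cycle_product css x \<noteq> x"
proof
  assume "cycle_product css x = x"
  then have *: "cycle_of_list cs x = x"
    using assms by (simp add: cycle_product_inside)
  have "distinct cs" using assms by (auto simp: distinct_concat_iff)
  have inj: "inj (cycle_of_list cs)" using cycle_permutes permutes_inj by blast
  have "(cycle_of_list cs y = x) = (y = x)" for y
    using * inj by (metis injD)
  then have "y = x" if "y \<in> set cs" for y
    using invariant_cycle_of_list[OF \<open>distinct cs\<close>, of "\<lambda>y. y = x" y x] that assms(3) by blast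
  then have "set cs \<subseteq> {x}" by auto
  then have "card (set cs) \<le> 1" using card_mono[of "{x}" "set cs"] by simp
  then show False using assms(4) \<open>distinct cs\<close> by (simp add: distinct_card)
qed

text \<open>A point on a cycle of length at least 2 is moved, so it also lies on a cycle of the
  other product; \<open>cycle_support_eq\<close> describes both supports through the common
  permutation.\<close>

lemma cycle_supports_subset:
  assumes "distinct (concat css)" "distinct (concat css')"
    and "\<forall>cs\<in>set css. 2 \<le> length cs"
    and "cycle_product css = cycle_product css'"
  shows "set ` set css \<subseteq> set ` set css'"
proof
  fix A assume "A \<in> set ` set css"
  then obtain cs where cs: "cs \<in> set css" "A = set cs" by auto
  then obtain x where x: "x \<in> set cs" using assms(3) by (cases cs) fastforce+
  then have "cycle_product css' x \<noteq> x"
    using cycle_product_moves[OF assms(1) cs(1) x] assms(3,4) cs by auto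
  then have "x \<in> set (concat css')" using cycle_product_outside by metis
  then obtain ds where ds: "ds \<in> set css'" "x \<in> set ds" by auto
  have "set cs = set ds"
    using cycle_support_eq[OF assms(1) cs(1) x] cycle_support_eq[OF assms(2) ds] assms(4) by simp
  then show "A \<in> set ` set css'" using cs ds by auto
qed

text \<open>Nonempty disjoint cycles have different supports, so passing to the set of supports
  loses no multiplicities.\<close>

lemma mset_lengths_eq_supports:
  assumes "distinct (concat css)" "\<forall>cs\<in>set css. 2 \<le> length cs"
  shows "mset (map length css) = image_mset card (mset_set (set ` set css))"
proof -
  have "[] \<notin> set css" using assms(2) by auto
  then have d: "distinct css" "inj_on set (set css)"
  proof -
    show "distinct css"
      using assms(1) \<open>[] \<notin> set css\<close> by (simp add: distinct_concat_iff removeAll_id)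
    show "inj_on set (set css)"
    proof (rule inj_onI)
      fix cs ds assume *: "cs \<in> set css" "ds \<in> set css" "set cs = set ds"
      then show "cs = ds"
        using assms(1) \<open>[] \<notin> set css\<close> unfolding distinct_concat_iff by (metis inf.idem set_empty)
    qed
  qed
  have "image_mset card (mset_set (set ` set css)) = image_mset card (image_mset set (mset css))"
    using d by (simp add: image_mset_mset_set[symmetric] mset_set_set)
  also have "\<dots> = image_mset length (mset css)"
    using assms(1) by (auto simp: image_mset.compositionality distinct_concat_iff distinct_card intro!: image_mset_cong)
  finally show ?thesis by simp
qed

lemma cycle_product_determines_lengths:
  assumes "distinct (concat css)" "distinct (concat css')"
    and "\<forall>cs\<in>set css. 2 \<le> length cs" "\<forall>cs\<in>set css'. 2 \<le> length cs"
    and "cycle_product css = cycle_product css'"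
  shows "mset (map length css) = mset (map length css')"
proof -
  have "set ` set css = set ` set css'"
    using cycle_supports_subset[OF assms(1,2,3,5)]
      cycle_supports_subset[OF assms(2,1,4) assms(5)[symmetric]] by (rule subset_antisym)
  then show ?thesis
    using mset_lengths_eq_supports[OF assms(1,3)] mset_lengths_eq_supports[OF assms(2,4)] by argo
qed

lemma cycle_decomp_cycle_product:
  assumes "cycle_decomp I p"
  shows "\<exists>css. distinct (concat css) \<and> set (concat css) \<subseteq> I \<and> (\<forall>cs\<in>set css. 2 \<le> length cs) \<and>
           p = cycle_product css"
  using assms
proof (induction rule: cycle_decomp.induct)
  case empty
  then show ?case by (intro exI[of _ "[]"]) simp
next
  case (comp I p cs)
  then obtain css where css: "distinct (concat css)" "set (concat css) \<subseteq> I"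
    "\<forall>cs\<in>set css. 2 \<le> length cs" "p = cycle_product css"
    by blast
  show ?case
  proof (cases "2 \<le> length cs")
    case True
    then show ?thesis
      using css comp.hyps by (intro exI[of _ "cs # css"]) auto
  next
    case False
    then have "cycle_of_list cs = id"
      by (cases cs rule: cycle_of_list.cases) auto
    then show ?thesis
      using css by (intro exI[of _ css]) auto
  qed
qed

lemma sorted_wrt_ge_unique:
  fixes l l' :: "nat list"
  assumes "sorted_wrt (\<ge>) l" "sorted_wrt (\<ge>) l'" "mset l = mset l'"
  shows "l = l'"
proof -
  have "sorted (rev l)" "sorted (rev l')"
    using assms by (simp_all add: sorted_wrt_rev)
  then have "rev l = rev l'"
    using assms(3) by (metis mset_rev properties_for_sort)
  then show ?thesis by simp
qed

section \<open>Conjugacy classes of finitary permutations\<close>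

lemma fsym_group_simps [simp]:
  "p \<otimes>\<^bsub>fsym_group X\<^esub> q = p \<circ> q"
  "\<one>\<^bsub>fsym_group X\<^esub> = id"
  "p \<in> carrier (fsym_group X) \<longleftrightarrow> p permutes X \<and> finite {x. p x \<noteq> x}"
  by (auto simp: fsym_group_def)

lemma inv_fsym_group:
  assumes "p \<in> carrier (fsym_group X)"
  shows "inv\<^bsub>fsym_group X\<^esub> p = inv' p"
proof -
  interpret group "fsym_group X" by (rule group_fsym_group)
  have p: "p permutes X" "finite {x. p x \<noteq> x}" using assms by auto
  have "{x. inv' p x \<noteq> x} = {x. p x \<noteq> x}"
    using permutes_inv_eq[OF p(1)] by metis
  then show ?thesis
    using p by (intro inv_equality) (auto simp: permutes_inv permutes_inv_o)
qed

lemma transpose_in_fsym_group: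
  assumes "x \<in> X" "y \<in> X"
  shows "Transposition.transpose x y \<in> carrier (fsym_group X)"
proof -
  have "{z. Transposition.transpose x y z \<noteq> z} \<subseteq> {x, y}"
    by (auto simp: Transposition.transpose_def)
  then have "finite {z. Transposition.transpose x y z \<noteq> z}"
    by (rule finite_subset) simp
  then show ?thesis
    using assms by (simp add: permutes_swap_id)
qed

text \<open>One point is added at a time: once \<open>h\<close> is right on \<open>xs\<close>, a
  transposition corrects \<open>h x\<close> to \<open>y\<close>. It leaves the images of
  \<open>xs\<close> alone, as they differ from \<open>h x\<close> by injectivity and from
  \<open>y\<close> by distinctness.\<close>

lemma exists_finitary_permutation_map:
  assumes "length xs = length ys" "distinct xs" "distinct ys" "set xs \<subseteq> X" "set ys \<subseteq> X"
  shows "\<exists>h\<in>carrier (fsym_group X). map h xs = ys"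
  using assms
proof (induction xs ys rule: list_induct2)
  case Nil
  then show ?case by (intro bexI[of _ id]) (simp_all add: permutes_id[unfolded id_def] permutes_id)
next
  case (Cons x xs y ys)
  then obtain h where h: "h \<in> carrier (fsym_group X)" "map h xs = ys"
    by auto
  have bij: "h permutes X" using h by simp
  let ?t = "Transposition.transpose (h x) y"
  have "?t \<in> carrier (fsym_group X)"
    using Cons.prems permutes_in_image[OF bij] by (intro transpose_in_fsym_group) auto
  then have "?t \<otimes>\<^bsub>fsym_group X\<^esub> h \<in> carrier (fsym_group X)"
    using h(1) group_fsym_group[of X] by (intro monoid.m_closed group.is_monoid)
  then have "?t \<circ> h \<in> carrier (fsym_group X)"
    by (simp only: fsym_group_simps(1))
  moreover have "?t (h z) = h z" if "z \<in> set xs" for z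
  proof -
    have "h z \<noteq> h x"
      using that Cons.prems permutes_inj[OF bij] by (auto simp: inj_eq)
    moreover have "h z \<noteq> y"
      using that Cons.prems h(2) by auto
    ultimately show ?thesis by simp
  qed
  then have "map (?t \<circ> h) (x # xs) = y # ys"
    using h(2) by auto
  ultimately show ?case by (intro bexI[of _ "?t \<circ> h"])
qed

lemma cycle_product_in_fsym_group:
  assumes "set (concat css) \<subseteq> X"
  shows "cycle_product css \<in> carrier (fsym_group X)"
proof -
  have "{x. cycle_product css x \<noteq> x} \<subseteq> set (concat css)"
    using cycle_product_outside by fastforce
  then have "finite {x. cycle_product css x \<noteq> x}"
    by (rule finite_subset) simp
  then show ?thesis
    using permutes_subset[OF cycle_product_permutes assms] by simp
qed

text \<open>Conjugation renames the entries of the cycles. Conversely, lists of cycles of the same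
  type have concatenations of equal length, and a finitary permutation carrying one to the other
  conjugates the products.\<close>

lemma conj_class_cycle_product:
  assumes css: "css \<in> cycle_type_lists X l"
  shows "conj_class (fsym_group X) (cycle_product css) = cycle_type_class X l"
proof (intro equalityI subsetI)
  fix p assume "p \<in> conj_class (fsym_group X) (cycle_product css)"
  then obtain h where h: "h \<in> carrier (fsym_group X)"
    and p: "p = h \<circ> cycle_product css \<circ> inv' h"
    unfolding conj_class_def by (auto simp only: inv_fsym_group fsym_group_simps(1))
  have "h permutes X" using h by simp
  then have "bij h" by (rule permutes_bij)
  have "inj_on h A" for A
    using \<open>bij h\<close> by (simp add: bij_def inj_on_def)
  then have "map (map h) css \<in> cycle_type_lists X l"
    using css permutes_in_image[OF \<open>h permutes X\<close>]
    by (auto simp: cycle_type_lists_def distinct_map comp_def simp flip: map_concat)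
  moreover have "p = cycle_product (map (map h) css)"
    using css \<open>bij h\<close> by (simp add: p conjugate_cycle_product cycle_type_lists_def)
  ultimately show "p \<in> cycle_type_class X l"
    by (auto simp: cycle_type_class_def)
next
  fix p assume "p \<in> cycle_type_class X l"
  then obtain css' where css': "css' \<in> cycle_type_lists X l" and p: "p = cycle_product css'"
    by (auto simp: cycle_type_class_def)
  have len: "map length css = map length css'"
    using css css' by (simp add: cycle_type_lists_def)
  then have "length (concat css) = length (concat css')"
    by (simp add: length_concat)
  then obtain h where h: "h \<in> carrier (fsym_group X)" "map h (concat css) = concat css'"
    using css css' exists_finitary_permutation_map[of "concat css" "concat css'" X]
    unfolding cycle_type_lists_def by auto
  \<comment> \<open>Equal block lengths allow the cycles to be read off from their
    concatenation.\<close>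
  have "map (map h) css = css'"
  proof (rule concat_injective)
    show "concat (map (map h) css) = concat css'"
      using h(2) by (simp add: map_concat)
    show "length (map (map h) css) = length css'"
      using len by (metis length_map)
    show "\<forall>(x, y)\<in>set (zip (map (map h) css) css'). length x = length y"
    proof clarify
      fix x y assume "(x, y) \<in> set (zip (map (map h) css) css')"
      then obtain i where "i < length css" "i < length css'" "x = map h (css ! i)" "y = css' ! i"
        by (auto simp: set_zip)
      then show "length x = length y"
        using len by (metis length_map nth_map)
    qed
  qed
  moreover have "bij h" using h(1) permutes_bij by auto
  ultimately have "p = h \<circ> cycle_product css \<circ> inv' h"
    using css by (simp add: p conjugate_cycle_product cycle_type_lists_def)
  also have "\<dots> = h \<otimes>\<^bsub>fsym_group X\<^esub> cycle_product css \<otimes>\<^bsub>fsym_group X\<^esub> inv\<^bsub>fsym_group X\<^esub> h"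
    by (simp only: inv_fsym_group[OF h(1)] fsym_group_simps(1))
  finally show "p \<in> conj_class (fsym_group X) (cycle_product css)"
    using h(1) unfolding conj_class_def by blast
qed

lemma cycle_type_exists:
  assumes "p \<in> carrier (fsym_group X)"
  shows "\<exists>l. int_partition l (sum_list l) \<and> p \<in> cycle_type_class X l"
proof -
  let ?S = "{x. p x \<noteq> x}"
  \<comment> \<open>The support of \<open>p\<close> is finite even if \<open>X\<close> is not, so a
    cycle decomposition exists over it.\<close>
  have "p permutes ?S"
    by (rule permutes_superset[of p X]) (use assms in auto)
  then have "cycle_decomp ?S p"
    using assms by (intro cycle_decomposition) auto
  from cycle_decomp_cycle_product[OF this] obtain css where
    css: "distinct (concat css)" "set (concat css) \<subseteq> ?S" "\<forall>cs\<in>set css. 2 \<le> length cs"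
    "p = cycle_product css"
    by blast
  \<comment> \<open>A partition needs decreasing lengths; reordering the disjoint cycles does not
    change the product.\<close>
  define css' where "css' = rev (sort_key length css)"
  define l where "l = map (\<lambda>cs. length cs - 1) css'"
  have mset: "mset css' = mset css" and set: "set css' = set css"
    by (simp_all add: css'_def)
  have "mset (concat css') = mset (concat css)"
    using mset by (metis mset_concat mset_map sum_mset_sum_list)
  then have "distinct (concat css')"
    using css(1) mset_eq_imp_distinct_iff by blast
  moreover have "?S \<subseteq> X"
    using assms by (auto simp: permutes_def)
  moreover have "map length css' = map Suc l"
    using css(3) set by (fastforce simp: l_def)
  ultimately have "css' \<in> cycle_type_lists X l"
    using css(2) set by (auto simp: cycle_type_lists_def)
  moreover have "p = cycle_product css'"
    using cycle_product_perm[OF css(1) mset] css(4) by simp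
  moreover have "int_partition l (sum_list l)"
  proof -
    have "sorted (map length (sort_key length css))"
      by simp
    then have "sorted_wrt (\<lambda>cs ds. length ds \<le> length cs) css'"
      by (simp add: css'_def sorted_wrt_rev sorted_wrt_map)
    then have "sorted_wrt (\<ge>) l"
      unfolding l_def sorted_wrt_map by (rule sorted_wrt_mono_rel[rotated]) auto
    moreover have "\<forall>i\<in>set l. 1 \<le> i"
      using css(3) set by (fastforce simp: l_def)
    ultimately show ?thesis by (simp add: int_partition_def)
  qed
  ultimately show ?thesis
    by (auto simp: cycle_type_class_def)
qed

text \<open>Positive parts mean cycles of length at least 2, whose lengths the permutation
  determines as a multiset; being sorted then fixes the list.\<close>

lemma cycle_type_unique:
  assumes "int_partition l n" "int_partition l' n'"
    and "p \<in> cycle_type_class X l" "p \<in> cycle_type_class X l'"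
  shows "l = l'"
proof -
  obtain css css' where css: "css \<in> cycle_type_lists X l" "css' \<in> cycle_type_lists X l'"
    "p = cycle_product css" "p = cycle_product css'"
    using assms(3,4) by (auto simp: cycle_type_class_def)
  have two: "\<forall>cs\<in>set ds. 2 \<le> length cs"
    if "int_partition k m" "ds \<in> cycle_type_lists X k" for k m ds
  proof
    fix cs assume "cs \<in> set ds"
    then have "length cs \<in> set (map Suc k)"
      using that(2)
      by (metis (mono_tags, lifting) cycle_type_lists_def image_eqI list.set_map mem_Collect_eq)
    then show "2 \<le> length cs"
      using that(1) by (auto simp: int_partition_def)
  qed
  have "mset (map length css) = mset (map length css')"
    by (rule cycle_product_determines_lengths)
      (use css two[OF assms(1) css(1)] two[OF assms(2) css(2)] in \<open>auto simp: cycle_type_lists_def\<close>)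
  then have "image_mset Suc (mset l) = image_mset Suc (mset l')"
    using css(1,2) by (simp add: cycle_type_lists_def flip: mset_map)
  then have "mset l = mset l'"
    using multiset.inj_map[of Suc] by (simp add: inj_eq)
  then show ?thesis
    using assms(1,2) by (auto simp: int_partition_def intro: sorted_wrt_ge_unique)
qed


section \<open>Products of transpositions\<close>

definition composition :: "('a \<Rightarrow> 'a) list \<Rightarrow> 'a \<Rightarrow> 'a" where
  "composition ws = foldr (\<circ>) ws id"

lemma composition_simps [simp]:
  "composition [] = id"
  "composition (w # ws) = w \<circ> composition ws"
  by (simp_all add: composition_def)

lemma composition_append [simp]: "composition (us @ ws) = composition us \<circ> composition ws"
  by (induction us) (auto simp: comp_assoc)

text \<open>Transpositions are their own inverses, so adjoining inverses adds no letters to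
  \<open>S\<close>.\<close>

lemma fsym_word_length:
  assumes "transposition_set X S"
  shows "word_length (fsym_group X) S p =
           (LEAST n. \<exists>ws. length ws = n \<and> set ws \<subseteq> S \<and> p = composition ws)"
proof -
  interpret group "fsym_group X" by (rule group_fsym_group)
  have "inv\<^bsub>fsym_group X\<^esub> s = s" if s: "s \<in> S" for s
  proof -
    obtain x y where xy: "s = Transposition.transpose x y" "x \<in> X" "y \<in> X"
      using s assms unfolding transposition_set_def by blast
    then show ?thesis
      using transpose_in_fsym_group[of x X y] by (intro inv_equality) (auto simp del: fsym_group_simps(3))
  qed
  then have "S \<union> m_inv (fsym_group X) ` S = S"
    by auto
  moreover have "monoid.mult (fsym_group X) = (\<circ>)"
    by (simp add: fsym_group_def)
  ultimately show ?thesis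
    unfolding word_length_def composition_def fsym_group_simps(2) by (simp only:)
qed

text \<open>Each further transposition merges at most two labels.\<close>

lemma exists_invariant_labelling:
  fixes V :: "'a set"
  assumes "transposition_set X S" "set ws \<subseteq> S" "finite V"
  shows "\<exists>c :: 'a \<Rightarrow> 'a. (\<forall>z. c (composition ws z) = c z) \<and> card V \<le> card (c ` V) + length ws"
  using assms(2)
proof (induction ws)
  case Nil
  show ?case by (intro exI[of _ id]) simp
next
  case (Cons w ws)
  then obtain c :: "'a \<Rightarrow> 'a" where c: "\<And>z. c (composition ws z) = c z" "card V \<le> card (c ` V) + length ws"
    by auto
  obtain x y where w: "w = Transposition.transpose x y"
    using Cons.prems assms(1) unfolding transposition_set_def by auto
  \<comment> \<open>The label \<open>c y\<close> is replaced by \<open>c x\<close>, so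
    \<open>w\<close> preserves the new labelling. Being a function of the old labels, it stays
    invariant under the rest of the word, and only the value \<open>c y\<close> can
    disappear.\<close>
  define c' where "c' z = (if c z = c y then c x else c z)" for z
  have "c' (w z) = c' z" for z
    by (auto simp: c'_def w Transposition.transpose_def)
  moreover have "c' (composition ws z) = c' z" for z
    by (simp add: c'_def c)
  moreover have "c ` V - {c y} \<subseteq> c' ` V"
    by (auto simp: c'_def)
  then have "card (c ` V - {c y}) \<le> card (c' ` V)"
    using assms(3) by (intro card_mono) auto
  then have "card (c ` V) \<le> card (c' ` V) + 1"
    using assms(3) by (auto simp: card_Diff_singleton_if split: if_splits)
  ultimately show ?case
    using c(2) by (intro exI[of _ c']) auto
qed

lemma card_support_cycle_type:
  assumes "css \<in> cycle_type_lists X l"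
  shows "card (set (concat css)) = sum_list l + length l"
proof -
  have "sum_list (map Suc k) = sum_list k + length k" for k
    by (induction k) auto
  then show ?thesis
    using assms distinct_card[of "concat css"]
    by (simp add: cycle_type_lists_def length_concat del: set_concat)
qed

text \<open>An invariant labelling takes one value per cycle, hence at most \<open>length l\<close>
  values on the \<open>sum_list l + length l\<close> points; a word shorter than
  \<open>sum_list l\<close> would leave more.\<close>

lemma word_length_lower_bound:
  fixes css :: "'a list list"
  assumes "transposition_set X S" "set ws \<subseteq> S" "css \<in> cycle_type_lists X l"
    and "cycle_product css = composition ws"
  shows "sum_list l \<le> length ws"
proof -
  let ?V = "set (concat css)"
  obtain c :: "'a \<Rightarrow> 'a" where c: "\<And>z. c (composition ws z) = c z" "card ?V \<le> card (c ` ?V) + length ws"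
    using exists_invariant_labelling[OF assms(1,2), of ?V] by blast
  have "c ` ?V \<subseteq> (\<lambda>cs. c (hd cs)) ` set css"
  proof
    fix a assume "a \<in> c ` ?V"
    then obtain cs x where x: "a = c x" "cs \<in> set css" "x \<in> set cs" by auto
    have "c x = c (hd cs)"
    proof (rule invariant_cycle_product[of css c cs])
      show "distinct (concat css)" "c (cycle_product css z) = c z" for z
        using assms(3,4) c(1) by (auto simp: cycle_type_lists_def)
      show "hd cs \<in> set cs"
        using x(3) by (intro hd_in_set) auto
    qed (use x in auto)
    then show "a \<in> (\<lambda>cs. c (hd cs)) ` set css" using x by auto
  qed
  then have "card (c ` ?V) \<le> card (set css)"
    by (rule surj_card_le[rotated]) simp
  also have "\<dots> \<le> length l"
    using assms(3) card_length[of css] map_eq_imp_length_eq by (fastforce simp: cycle_type_lists_def)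
  finally show ?thesis
    using c(2) card_support_cycle_type[OF assms(3)] by simp
qed

section \<open>Words obtained from connected graphs and forests\<close>

lemma transposition_edgesD: "{x, y} \<in> transposition_edges S \<Longrightarrow> Transposition.transpose x y \<in> S"
  by (auto simp: transposition_edges_def doubleton_eq_iff transpose_commute)

lemma rtrancl_leaves_set:
  assumes "(x, y) \<in> r\<^sup>*" "x \<in> A" "y \<notin> A"
  shows "\<exists>u v. (u, v) \<in> r \<and> u \<in> A \<and> v \<notin> A"
  using assms by (induction rule: rtrancl_induct) auto

text \<open>Multiplying a cycle through \<open>u\<close> by the transposition of an edge \<open>u v\<close> with \<open>v\<close> outside the
  cycle inserts \<open>v\<close> next to \<open>u\<close>.\<close>

lemma connected_graph_cycle_word:
  assumes V: "simple_graph V E" "connected_graph V E" "finite V"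
    and E: "E \<subseteq> transposition_edges S" and k: "k < card V"
  shows "\<exists>cs ws. distinct cs \<and> set cs \<subseteq> V \<and> length cs = Suc k \<and>
           set ws \<subseteq> S \<and> length ws = k \<and> composition ws = cycle_of_list cs"
  using k
proof (induction k)
  case 0
  then obtain x where "x \<in> V" by fastforce
  then show ?case by (intro exI[of _ "[x]"] exI[of _ "[]"]) simp
next
  case (Suc k)
  then obtain cs ws where cs: "distinct cs" "set cs \<subseteq> V" "length cs = Suc k"
    and ws: "set ws \<subseteq> S" "length ws = k" "composition ws = cycle_of_list cs"
    by auto
  have "card (set cs) < card V"
    using cs Suc.prems by (simp add: distinct_card)
  then obtain y where y: "y \<in> V" "y \<notin> set cs"
    using V(3) by (metis card_mono finite_set linorder_not_less subsetI)
  have "hd cs \<in> set cs"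
    using cs(3) by (intro hd_in_set) auto
  \<comment> \<open>A path from the cycle to the outside point \<open>y\<close> contains an edge
    that leaves the support of the cycle.\<close>
  then obtain u v where uv: "{u, v} \<in> E" "u \<in> set cs" "v \<notin> set cs"
    using V(2) cs(2) y rtrancl_leaves_set[of "hd cs" y "{(u, v). {u, v} \<in> E}" "set cs"]
    unfolding connected_graph_def by blast
  then have "v \<in> V"
    using V(1) by (fastforce simp: simple_graph_def doubleton_eq_iff)
  obtain as bs where asbs: "cs = as @ u # bs"
    using split_list[OF uv(2)] by auto
  \<comment> \<open>Once the cycle is written starting at \<open>u\<close>,
    \<open>cycle_of_list (v # u # bs @ as)\<close> unfolds to the transposition of \<open>v\<close>
    and \<open>u\<close> followed by the old cycle as right factor.\<close>
  have rot: "rotate (length as) cs = u # bs @ as"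
    unfolding asbs by (simp add: rotate_append)
  have "composition (Transposition.transpose v u # ws) = cycle_of_list (v # u # bs @ as)"
    using ws(3) cycle_of_list_rotate_independent[OF cs(1), of "length as"] by (simp add: rot)
  moreover have "Transposition.transpose v u \<in> S"
    using uv(1) E transposition_edgesD[of u v S] by (auto simp: transpose_commute)
  ultimately show ?case
    using cs ws uv \<open>v \<in> V\<close> asbs
    by (intro exI[of _ "v # u # bs @ as"] exI[of _ "Transposition.transpose v u # ws"]) auto
qed

text \<open>Each tree yields a cycle through all its vertices. Disjoint vertex sets keep these
  cycles disjoint, so concatenating the words gives a product of the required type.\<close>

lemma forest_word:
  assumes "contains_forest X (transposition_edges S) (map Suc l)"
  shows "\<exists>css ws. css \<in> cycle_type_lists X l \<and> set ws \<subseteq> S \<and> length ws = sum_list l \<and>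
           composition ws = cycle_product css"
proof -
  obtain V F where VF: "\<And>i. i < length l \<Longrightarrow> V i \<subseteq> X \<and> F i \<subseteq> transposition_edges S \<and>
      tree (V i) (F i) \<and> card (V i) = Suc (l ! i)" and disj: "disjoint_family_on V {..<length l}"
    using assms by (auto simp: contains_forest_def)
  have "\<forall>i<length l. \<exists>cs ws. distinct cs \<and> set cs \<subseteq> V i \<and> length cs = Suc (l ! i) \<and>
           set ws \<subseteq> S \<and> length ws = l ! i \<and> composition ws = cycle_of_list cs"
  proof (intro allI impI)
    fix i assume "i < length l"
    \<comment> \<open>The cardinality is positive, whereas \<open>card\<close> is 0 on infinite
      sets; hence \<open>V i\<close> is finite.\<close>
    from VF[OF this] have "simple_graph (V i) (F i)" "connected_graph (V i) (F i)" "finite (V i)"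
      "F i \<subseteq> transposition_edges S" "l ! i < card (V i)"
      by (simp_all add: tree_def card_ge_0_finite)
    then show "\<exists>cs ws. distinct cs \<and> set cs \<subseteq> V i \<and> length cs = Suc (l ! i) \<and>
           set ws \<subseteq> S \<and> length ws = l ! i \<and> composition ws = cycle_of_list cs"
      by (rule connected_graph_cycle_word)
  qed
  then obtain C W where CW: "\<And>i. i < length l \<Longrightarrow> distinct (C i) \<and> set (C i) \<subseteq> V i \<and>
      length (C i) = Suc (l ! i) \<and> set (W i) \<subseteq> S \<and> length (W i) = l ! i \<and>
      composition (W i) = cycle_of_list (C i)"
    by metis
  have disjC: "set (C i) \<inter> set (C j) = {}" if "i < length l" "j < length l" "i \<noteq> j" for i j
    using CW[OF that(1)] CW[OF that(2)] that disj unfolding disjoint_family_on_def by blast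
  have "distinct (concat (map C [0..<n])) \<and>
      composition (concat (map W [0..<n])) = cycle_product (map C [0..<n])" if "n \<le> length l" for n
    using that
  proof (induction n)
    case (Suc n)
    have "composition (concat (map W [0..<Suc n])) = cycle_product (map C [0..<n]) \<circ> cycle_of_list (C n)"
      using Suc CW[of n] by simp
    also have "\<dots> = cycle_product (map C [0..<Suc n])"
    proof -
      have "cycle_product (css @ [cs]) = cycle_product css \<circ> cycle_of_list cs" for css and cs :: "'a list"
        by (induction css) (auto simp: comp_assoc)
      then show ?thesis by simp
    qed
    finally have "composition (concat (map W [0..<Suc n])) = cycle_product (map C [0..<Suc n])" .
    moreover have "set (C i) \<inter> set (C n) = {}" if "i < n" for i
      using disjC[of i n] that Suc.prems by simp
    then have "set (concat (map C [0..<n])) \<inter> set (C n) = {}"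
      by fastforce
    ultimately show ?case
      using Suc CW[of n] by simp
  qed simp
  then have "distinct (concat (map C [0..<length l]))"
    "composition (concat (map W [0..<length l])) = cycle_product (map C [0..<length l])"
    by auto
  moreover have "map length (map C [0..<length l]) = map Suc l"
    using CW by (intro nth_equalityI) auto
  moreover have "set (concat (map C [0..<length l])) \<subseteq> X"
    using CW VF by fastforce
  moreover have "map length (map W [0..<length l]) = l"
    using CW by (intro nth_equalityI) auto
  then have "length (concat (map W [0..<length l])) = sum_list l"
    by (metis length_concat)
  moreover have "set (concat (map W [0..<length l])) \<subseteq> S"
    using CW by fastforce
  ultimately show ?thesis
    unfolding cycle_type_lists_def by blast
qed

text \<open>Along a path, conjugating the transposition of \<open>x\<close> and \<open>y\<close> by
  that of the edge \<open>{y, z}\<close> gives the transposition of \<open>x\<close> and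
  \<open>z\<close>. This is why connectedness makes \<open>S\<close> generate.\<close>

lemma transpose_word:
  assumes "(x, y) \<in> {(u, v). {u, v} \<in> transposition_edges S}\<^sup>*"
  shows "\<exists>ws. set ws \<subseteq> S \<and> composition ws = Transposition.transpose x y"
  using assms
proof (induction rule: rtrancl_induct)
  case base
  show ?case by (intro exI[of _ "[]"]) simp
next
  case (step y z)
  then obtain ws where ws: "set ws \<subseteq> S" "composition ws = Transposition.transpose x y"
    by auto
  have yz: "Transposition.transpose y z \<in> S"
    using step transposition_edgesD by fastforce
  let ?t = "Transposition.transpose y z"
  \<comment> \<open>Conjugation fails when the path returns to \<open>x\<close> or is still there:
    the results are then the identity and the edge itself.\<close>
  consider "x = z" | "x = y" | "x \<noteq> z" "x \<noteq> y" by auto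
  then show ?case
  proof cases
    case 1
    then show ?thesis by (intro exI[of _ "[]"]) simp
  next
    case 2
    then show ?thesis using yz by (intro exI[of _ "[?t]"]) simp
  next
    case 3
    have "composition (?t # ws @ [?t]) = ?t \<circ> Transposition.transpose x y \<circ> ?t"
      using ws(2) by (simp add: comp_assoc)
    also have "\<dots> = Transposition.transpose x z"
      using 3 by (auto simp: fun_eq_iff Transposition.transpose_def)
    finally show ?thesis
      using ws(1) yz by (intro exI[of _ "?t # ws @ [?t]"]) auto
  qed
qed

lemma cycle_of_list_word:
  assumes "connected_graph X (transposition_edges S)" "set cs \<subseteq> X"
  shows "\<exists>ws. set ws \<subseteq> S \<and> composition ws = cycle_of_list cs"
  using assms(2)
proof (induction cs rule: cycle_of_list.induct)
  case (1 i j cs)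
  then obtain ws where ws: "set ws \<subseteq> S" "composition ws = cycle_of_list (j # cs)"
    by auto
  obtain us where us: "set us \<subseteq> S" "composition us = Transposition.transpose i j"
    using transpose_word[of i j S] assms(1) 1(2) by (auto simp: connected_graph_def)
  show ?case
    using ws us by (intro exI[of _ "us @ ws"]) simp
qed (auto intro!: exI[of _ "[]"])

text \<open>Guarantees that the \<open>LEAST\<close> in the word length ranges over a nonempty
  set.\<close>

lemma cycle_product_word:
  assumes "connected_graph X (transposition_edges S)" "set (concat css) \<subseteq> X"
  shows "\<exists>ws. set ws \<subseteq> S \<and> composition ws = cycle_product css"
  using assms(2)
proof (induction css)
  case (Cons cs css)
  then obtain ws where ws: "set ws \<subseteq> S" "composition ws = cycle_product css"
    by auto
  obtain us where us: "set us \<subseteq> S" "composition us = cycle_of_list cs"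
    using cycle_of_list_word[OF assms(1), of cs] Cons.prems by auto
  show ?case
    using ws us by (intro exI[of _ "us @ ws"]) simp
qed (auto intro!: exI[of _ "[]"])


section \<open>Conjugacy growth of finitary symmetric groups\<close>

text \<open>The number \<open>n + length l\<close> counts the points moved by cycle type
  \<open>l\<close>. The guard is there because \<open>card X = 0\<close> for infinite
  \<open>X\<close>.\<close>

definition partitions_fitting :: "'a set \<Rightarrow> nat \<Rightarrow> nat list set" where
  "partitions_fitting X n = {l. int_partition l n \<and> (finite X \<longrightarrow> n + length l \<le> card X)}"

lemma cycle_type_fits:
  assumes "int_partition l n" "css \<in> cycle_type_lists X l"
  shows "l \<in> partitions_fitting X n"
  using assms card_support_cycle_type[OF assms(2)] card_mono[of X "set (concat css)"]
  by (auto simp: partitions_fitting_def int_partition_def cycle_type_lists_def)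

text \<open>The lower bound holds for every element of the class, and the forest supplies one
  element that attains it.\<close>

lemma conj_length_cycle_type:
  assumes S: "transposition_set X S" "partition_complete X S"
    and l: "int_partition l n" and p: "p \<in> cycle_type_class X l"
  shows "conj_length (fsym_group X) S p = n"
proof -
  obtain css where css: "css \<in> cycle_type_lists X l" "p = cycle_product css"
    using p by (auto simp: cycle_type_class_def)
  have K: "conj_class (fsym_group X) p = cycle_type_class X l"
    using conj_class_cycle_product[OF css(1)] css(2) by simp
  have n: "sum_list l = n" using l by (simp add: int_partition_def)
  have lower: "n \<le> word_length (fsym_group X) S h" if h: "h \<in> cycle_type_class X l" for h
  proof -
    obtain ds where ds: "ds \<in> cycle_type_lists X l" "h = cycle_product ds"
      using h by (auto simp: cycle_type_class_def)
    have "\<exists>ws. set ws \<subseteq> S \<and> composition ws = h"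
      using cycle_product_word[of X S ds] S(2) ds
      by (simp add: partition_complete_def cycle_type_lists_def)
    then have "\<exists>m ws. length ws = m \<and> set ws \<subseteq> S \<and> h = composition ws"
      by blast
    then have "\<exists>ws. length ws = word_length (fsym_group X) S h \<and> set ws \<subseteq> S \<and> h = composition ws"
      unfolding fsym_word_length[OF S(1)] by (rule LeastI_ex)
    then obtain ws where ws: "length ws = word_length (fsym_group X) S h" "set ws \<subseteq> S"
      "h = composition ws"
      by blast
    then show ?thesis
      using word_length_lower_bound[OF S(1) ws(2) ds(1)] ds(2) n by simp
  qed
  have "contains_forest X (transposition_edges S) (map Suc l)"
    using cycle_type_fits[OF l css(1)] S(2) by (auto simp: partition_complete_def partitions_fitting_def)
  from forest_word[OF this] obtain ds ws where ds: "ds \<in> cycle_type_lists X l"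
    and ws: "set ws \<subseteq> S" "length ws = n" "composition ws = cycle_product ds"
    unfolding n by blast
  have ds_class: "cycle_product ds \<in> cycle_type_class X l"
    using ds by (auto simp: cycle_type_class_def)
  have "word_length (fsym_group X) S (cycle_product ds) \<le> n"
    unfolding fsym_word_length[OF S(1)] using ws by (intro Least_le) metis
  with lower[OF ds_class] have "word_length (fsym_group X) S (cycle_product ds) = n"
    by simp
  then show ?thesis
    unfolding conj_length_def K using lower ds_class by (intro Least_equality) auto
qed

lemma conj_classes_of_length_eq:
  assumes S: "transposition_set X S" "partition_complete X S"
  shows "conj_classes_of_length (fsym_group X) S n = cycle_type_class X ` partitions_fitting X n"
proof (intro equalityI subsetI)
  fix K assume "K \<in> conj_classes_of_length (fsym_group X) S n"
  then obtain p where p: "p \<in> carrier (fsym_group X)" "K = conj_class (fsym_group X) p"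
    and n: "\<forall>g\<in>K. conj_length (fsym_group X) S g = n"
    by (auto simp only: conj_classes_of_length_def)
  obtain l where l: "int_partition l (sum_list l)" "p \<in> cycle_type_class X l"
    using cycle_type_exists[OF p(1)] by blast
  then obtain css where css: "css \<in> cycle_type_lists X l" "p = cycle_product css"
    by (auto simp: cycle_type_class_def)
  have K: "K = cycle_type_class X l"
    using conj_class_cycle_product[OF css(1)] css(2) p(2) by simp
  then have "sum_list l = n"
    using conj_length_cycle_type[OF S l] n l(2) by simp
  then show "K \<in> cycle_type_class X ` partitions_fitting X n"
    using cycle_type_fits[OF _ css(1)] l(1) K by auto
next
  fix K assume "K \<in> cycle_type_class X ` partitions_fitting X n"
  then obtain l where l: "l \<in> partitions_fitting X n" "K = cycle_type_class X l" by auto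
  then have part: "int_partition l n" by (simp add: partitions_fitting_def)
  \<comment> \<open>Here the forest serves to show that the class is nonempty.\<close>
  then have "contains_forest X (transposition_edges S) (map Suc l)"
    using l(1) S(2) by (auto simp: partition_complete_def partitions_fitting_def)
  from forest_word[OF this] obtain css where css: "css \<in> cycle_type_lists X l"
    by blast
  then have "K = conj_class (fsym_group X) (cycle_product css)"
    using conj_class_cycle_product[OF css] l(2) by simp
  moreover have "cycle_product css \<in> carrier (fsym_group X)"
    using css by (intro cycle_product_in_fsym_group) (simp add: cycle_type_lists_def)
  ultimately show "K \<in> conj_classes_of_length (fsym_group X) S n"
    using conj_length_cycle_type[OF S part] l(2) unfolding conj_classes_of_length_def by auto
qed

lemma finite_partitions_fitting: "finite (partitions_fitting X n)"
  unfolding partitions_fitting_def by (rule finite_subset[OF _ finite_int_partition]) auto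

lemma finite_conj_growth_fsym_group:
  assumes "transposition_set X S" "partition_complete X S"
  shows "finite_conj_growth (fsym_group X) S"
  using assms by (simp add: finite_conj_growth_def conj_classes_of_length_eq finite_partitions_fitting)

text \<open>Different fitting partitions give different classes: each class is nonempty by the
  forest, and a permutation has only one cycle type.\<close>

lemma conj_growth_fsym_group:
  assumes S: "transposition_set X S" "partition_complete X S"
  shows "conj_growth (fsym_group X) S n = card (partitions_fitting X n)"
proof -
  have "inj_on (cycle_type_class X) (partitions_fitting X n)"
  proof (rule inj_onI)
    fix l l' assume *: "l \<in> partitions_fitting X n" "l' \<in> partitions_fitting X n"
      "cycle_type_class X l = cycle_type_class X l'"
    then have "contains_forest X (transposition_edges S) (map Suc l)"
      using S(2) by (auto simp: partition_complete_def partitions_fitting_def)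
    from forest_word[OF this] obtain p where "p \<in> cycle_type_class X l"
      by (auto simp: cycle_type_class_def)
    then show "l = l'"
      using * cycle_type_unique[of l n l' n p X] by (simp add: partitions_fitting_def)
  qed
  then show ?thesis
    by (simp add: conj_growth_def conj_classes_of_length_eq[OF S] card_image)
qed

lemma conj_growth_infinite:
  assumes "infinite X" "transposition_set X S" "partition_complete X S"
  shows "conj_growth (fsym_group X) S n = num_partitions n"
  using assms by (simp add: conj_growth_fsym_group partitions_fitting_def num_partitions_def)

lemma conj_growth_finite:
  assumes "1 \<le> n" "transposition_set {1..n} S" "partition_complete {1..n} S"
  shows "conj_growth (fsym_group {1..n}) S k = (if k < n then num_partitions_into (n - k) n else 0)"
proof (cases "k < n")
  case True
  then show ?thesis
    using assms card_partitions_fitting[OF True]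
    by (simp add: conj_growth_fsym_group partitions_fitting_def)
next
  case False
  \<comment> \<open>From \<open>k \<ge> n \<ge> 1\<close> there is at least one part, so
    \<open>k + length l\<close> exceeds \<open>n\<close>.\<close>
  have "\<not> k + length l \<le> n" if "int_partition l k" for l
    using that False assms(1) by (cases l) (auto simp: int_partition_def)
  then have "partitions_fitting {1..n} k = {}"
    by (auto simp: partitions_fitting_def)
  then show ?thesis
    using assms False by (simp add: conj_growth_fsym_group)
qed

section \<open>The growth series and their coefficientwise limit\<close>

lemma conj_growth_series_infinite:
  assumes "infinite X" "transposition_set X S" "partition_complete X S"
  shows "conj_growth_series (fsym_group X) S = Abs_fps (\<lambda>m. real (num_partitions m))"
  using assms by (simp add: conj_growth_series_def conj_growth_infinite)

lemma conj_growth_series_finite: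
  assumes "1 \<le> n" "transposition_set {1..n} S" "partition_complete {1..n} S"
  shows "conj_growth_series (fsym_group {1..n}) S =
           (\<Sum>k=0..n-1. fps_const (real (num_partitions_into (n - k) n)) * fps_X ^ k)"
proof (rule fps_ext)
  fix k
  have "k \<le> n - 1 \<longleftrightarrow> k < n"
    using assms(1) by auto
  then show "fps_nth (conj_growth_series (fsym_group {1..n}) S) k =
      fps_nth (\<Sum>k=0..n-1. fps_const (real (num_partitions_into (n - k) n)) * fps_X ^ k) k"
    by (simp add: conj_growth_series_def conj_growth_finite[OF assms] fps_sum_nth fps_X_power_nth
        if_distrib[of "\<lambda>x. _ * x"] cong: if_cong del: One_nat_def)
qed

theorem proposition8:
  fixes X :: "'a set" and S :: "('a \<Rightarrow> 'a) set"
  assumes "infinite X"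
    and "transposition_set X S"
    and "partition_complete X S"
  shows
    "(finite_conj_growth (fsym_group X) S \<and>
      conj_growth_series (fsym_group X) S = Abs_fps (\<lambda>m. real (num_partitions m)) \<and>
      (\<lambda>j. inverse (1 - fps_X ^ Suc j)) has_prod conj_growth_series (fsym_group X) S \<and>
      (\<forall>(Y :: 'b set) T. infinite Y \<and> transposition_set Y T \<and> partition_complete Y T \<longrightarrow>
         conj_growth_series (fsym_group Y) T = conj_growth_series (fsym_group X) S)) \<and>
     (\<forall>Sn :: nat \<Rightarrow> (nat \<Rightarrow> nat) set.
        (\<forall>n\<ge>1. transposition_set {1..n} (Sn n) \<and> partition_complete {1..n} (Sn n)) \<longrightarrow>
        (\<forall>n\<ge>1. finite_conj_growth (fsym_group {1..n}) (Sn n) \<and>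
           conj_growth_series (fsym_group {1..n}) (Sn n) =
             (\<Sum>k=0..n-1. fps_const (real (num_partitions_into (n - k) n)) * fps_X ^ k)) \<and>
        (\<lambda>j. inverse (1 - fps_const (fps_X ^ j) * fps_X ^ Suc j)) has_prod
          Abs_fps (\<lambda>n. if n = 0 then 1 else conj_growth_series (fsym_group {1..n}) (Sn n)) \<and>
        (\<forall>k. (\<lambda>n. fps_nth (conj_growth_series (fsym_group {1..n}) (Sn n)) k)
               \<longlonglongrightarrow> fps_nth (conj_growth_series (fsym_group X) S) k))"
proof (intro conjI allI impI)
  show "finite_conj_growth (fsym_group X) S"
    using assms by (simp add: finite_conj_growth_fsym_group)
  show series: "conj_growth_series (fsym_group X) S = Abs_fps (\<lambda>m. real (num_partitions m))"
    using assms by (rule conj_growth_series_infinite)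
  show "(\<lambda>j. inverse (1 - fps_X ^ Suc j)) has_prod conj_growth_series (fsym_group X) S"
    unfolding series by (rule partition_product_num_partitions)
  show "conj_growth_series (fsym_group Y) T = conj_growth_series (fsym_group X) S"
    if "infinite Y \<and> transposition_set Y T \<and> partition_complete Y T" for Y :: "'b set" and T
    unfolding series using that by (intro conj_growth_series_infinite) auto
next
  fix Sn :: "nat \<Rightarrow> (nat \<Rightarrow> nat) set"
  assume Sn: "\<forall>n\<ge>1. transposition_set {1..n} (Sn n) \<and> partition_complete {1..n} (Sn n)"
  show "finite_conj_growth (fsym_group {1..n}) (Sn n)" if "1 \<le> n" for n
    using Sn that by (intro finite_conj_growth_fsym_group) auto
  show series: "conj_growth_series (fsym_group {1..n}) (Sn n) =
      (\<Sum>k=0..n-1. fps_const (real (num_partitions_into (n - k) n)) * fps_X ^ k)" if "1 \<le> n" for n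
    using Sn that by (intro conj_growth_series_finite) auto
  have bivariate: "(\<lambda>n. if n = 0 then 1 else conj_growth_series (fsym_group {1..n}) (Sn n)) =
      (\<lambda>n. if n = 0 then 1 else
        \<Sum>k=0..n-1. fps_const (real (num_partitions_into (n - k) n)) * fps_X ^ k)"
  proof
    fix n :: nat
    show "(if n = 0 then 1 else conj_growth_series (fsym_group {1..n}) (Sn n)) =
      (if n = 0 then 1 else
        \<Sum>k=0..n-1. fps_const (real (num_partitions_into (n - k) n)) * fps_X ^ k)"
    proof (cases "n = 0")
      case False
      then have "1 \<le> n" by simp
      from series[OF this] False show ?thesis
        by (simp only: if_False)
    qed simp
  qed
  show "(\<lambda>j. inverse (1 - fps_const (fps_X ^ j) * fps_X ^ Suc j)) has_prod
      Abs_fps (\<lambda>n. if n = 0 then 1 else conj_growth_series (fsym_group {1..n}) (Sn n))"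
    unfolding bivariate by (rule partition_product_num_partitions_into)
  show "(\<lambda>n. fps_nth (conj_growth_series (fsym_group {1..n}) (Sn n)) k)
      \<longlonglongrightarrow> fps_nth (conj_growth_series (fsym_group X) S) k" for k
  proof (rule tendsto_eventually, rule eventually_sequentiallyI)
    \<comment> \<open>A partition of \<open>k\<close> has at most \<open>k\<close> parts, so
      \<open>2 * k\<close> points accommodate every cycle type; the extra 1 ensures
      \<open>1 \<le> n\<close> when \<open>k = 0\<close>.\<close>
    fix n assume n: "2 * k + 1 \<le> n"
    have "k + length l \<le> n" if "int_partition l k" for l
      using that length_le_sum_list[of l] n by (auto simp: int_partition_def)
    then have "partitions_fitting {1..n} k = {l. int_partition l k}"
      by (auto simp: partitions_fitting_def)
    then have "conj_growth (fsym_group {1..n}) (Sn n) k = num_partitions k"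
      using Sn n by (subst conj_growth_fsym_group) (auto simp: num_partitions_def)
    then show "fps_nth (conj_growth_series (fsym_group {1..n}) (Sn n)) k =
        fps_nth (conj_growth_series (fsym_group X) S) k"
      unfolding conj_growth_series_infinite[OF assms] by (simp add: conj_growth_series_def)
  qed
qed

end
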